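(* Let $t,r$ be positive integers and $q=2^r$. Then there exists a dictionary $D$ in $\mathbb{R}^{q^{2t}}$ which is a union of $q+1$ orthonormal bases of $\mathbb{R}^{q^{2t}}$ and satisfies $\eta(D)=q^t+q^{t-1}$ and $\mu(D)=\frac{1}{q^t}$.
   Context: A dictionary of $\mathbb{R}^n$ is a family of $N\ge n$ unit column vectors $d_1,\dots,d_N$ spanning $\mathbb{R}^n$, written as the matrix $D=[d_1,\dots,d_N]$. "$D$ is a union of $k$ orthonormal bases" means its columns are the vectors of $k$ orthonormal bases of $\mathbb{R}^n$ (so $N=kn$). The mutual coherence is $\mu(D)=\max_{i\ne j}|\langle d_i,d_j\rangle|$. The spark $\eta(D)$ is the smallest number of columns of $D$ that are linearly dependent, i.e. $\eta(D)=\min\{\|x\|_0 : x\in\ker(D),\ x\neq 0\}$, where $\|x\|_0$ is the number of nonzero entries of $x$. *)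

theory Defs
  imports Complex_Main "HOL-Library.Multiset" "Jordan_Normal_Form.Matrix_Kernel"
begin

definition dictionary :: "nat \<Rightarrow> real mat \<Rightarrow> bool" where
  "dictionary n D \<longleftrightarrow>
     dim_row D = n \<and> n \<le> dim_col D \<and>
     (\<forall>j<dim_col D. sqrt (col D j \<bullet> col D j) = 1) \<and>
     LinearCombinations.module.span class_ring (module_vec TYPE(real) n) (set (cols D))
       = carrier_vec n"

definition orthonormal_basis :: "nat \<Rightarrow> real vec set \<Rightarrow> bool" where
  "orthonormal_basis n B \<longleftrightarrow>
     vectorspace.basis class_ring (module_vec TYPE(real) n) B \<and>
     (\<forall>u\<in>B. \<forall>v\<in>B. u \<bullet> v = (if u = v then 1 else 0))"

(* The columns are compared as a multiset: their order is irrelevant, and a vector that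
   belonged to several of the bases would be repeated as a column, so that
   dim_col D = k * n always holds. *)
definition union_of_orthonormal_bases :: "nat \<Rightarrow> nat \<Rightarrow> real mat \<Rightarrow> bool" where
  "union_of_orthonormal_bases n k D \<longleftrightarrow>
     (\<exists>B. (\<forall>i<k. orthonormal_basis n (B i)) \<and>
          mset (cols D) = (\<Sum>i<k. mset_set (B i)))"

(* Meaningful when D has at least two columns. *)
definition mutual_coherence :: "real mat \<Rightarrow> real" where
  "mutual_coherence D =
     Max {\<bar>col D i \<bullet> col D j\<bar> | i j. i < dim_col D \<and> j < dim_col D \<and> i \<noteq> j}"

definition l0_norm :: "real vec \<Rightarrow> nat" where
  "l0_norm x = card {i. i < dim_vec x \<and> x $ i \<noteq> 0}"

(* The set is finite, being bounded by dim_col D; it is nonempty iff the kernel is nontrivial. *)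
definition spark :: "real mat \<Rightarrow> nat" where
  "spark D = Min {l0_norm x | x. x \<in> mat_kernel D \<and> x \<noteq> 0\<^sub>v (dim_col D)}"

end

theory Submission
  imports "HOL-Algebra.Algebraic_Closure_Type" "HOL-Library.Z2" Defs
begin

text \<open>
  Let \<open>E\<close> be the field with \<open>q ^ (2 * t)\<close> elements, \<open>L\<close> and \<open>K\<close> its subfields with \<open>q ^ t\<close> and \<open>q\<close>
  elements, and index coordinates by \<open>E\<close>. Besides the standard basis take, for each \<open>a \<in> K\<close>, the
  basis of the normalised functions \<open>x \<mapsto> (-1) ^ (Tr (a * N x) + Tr (w * x))\<close>, \<open>w \<in> E\<close>, where \<open>N\<close>
  is the norm from \<open>E\<close> to \<open>L\<close> and both traces go down to the prime field. The quadratic forms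
  \<open>Tr (c * N x)\<close> with \<open>c \<noteq> 0\<close> are nondegenerate, so Gauss sums give coherence \<open>1 / q ^ t\<close>.

  The lower bound on the spark holds for any union of \<open>q + 1\<close> orthonormal bases of this coherence:
  every entry of a kernel vector is at most the coherence times the l1-norm of the other blocks.
  For the upper bound let \<open>U\<close> be the kernel of the trace from \<open>L\<close> to \<open>K\<close>. It is totally singular for
  the elliptic form \<open>Tr (N x)\<close> with values in \<open>K\<close>, which is anisotropic on the orthogonal space of
  \<open>U\<close> modulo \<open>U\<close>. Hence the sum of the basis vectors over all \<open>a \<in> K\<close> and \<open>w \<in> U\<close> is a multiple of
  the indicator function of \<open>U\<close>, a dependency with \<open>card U\<close> vectors in each basis.
\<close>

subsection \<open>Finite fields of characteristic two\<close>

text \<open>All finite fields are taken inside one algebraic closure of the two-element field, so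
  that subfields are subsets and no embeddings occur.\<close>

type_synonym gf = "bit alg_closure"

lemma CHAR_bit [simp]: "CHAR(bit) = 2"
proof (rule CHAR_eqI)
  have "of_nat n = (0::bit) \<longleftrightarrow> even n" for n
    by (induction n) auto
  then show "2 dvd n" if "of_nat n = (0::bit)" for n
    using that by simp
qed simp

lemma prime_CHAR_gf: "prime CHAR(gf)"
  by simp

lemma gf_add_self [simp]: "x + x = (0::gf)"
proof -
  have "of_nat 2 = (0::gf)" using of_nat_CHAR[where 'a=gf] by simp
  then show ?thesis by (metis mult_2 mult_zero_left of_nat_numeral)
qed

lemma gf_add_left_cancel [simp]: "x + (x + y) = (y::gf)"
  by (simp flip: add.assoc)

lemma gf_minus [simp]: "- x = (x::gf)"
  using gf_add_self by (metis add_eq_0_iff)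

lemma gf_diff [simp]: "x - y = (x + y::gf)"
  using diff_conv_add_uminus[of x y] by simp

lemma gf_add_eq_0_iff: "x + y = 0 \<longleftrightarrow> x = (y::gf)"
  using gf_diff eq_iff_diff_eq_0 by metis

lemma gf_add_power [simp]: "(x + y) ^ 2 ^ k = x ^ 2 ^ k + (y::gf) ^ 2 ^ k"
  using freshmans_dream'[OF prime_CHAR_gf, of "2^k" k x y] by simp

lemma gf_sum_power: "sum f A ^ 2 ^ k = (\<Sum>i\<in>A. (f i :: gf) ^ 2 ^ k)"
  using freshmans_dream_sum'[OF prime_CHAR_gf, of "2^k" k f A] by simp

text \<open>The fixed points of the \<open>k\<close>-fold Frobenius; for \<open>k > 0\<close> they
  form the subfield with \<open>2 ^ k\<close> elements.\<close>

definition GF :: "nat \<Rightarrow> gf set" where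
  "GF k = {x. x ^ 2 ^ k = x}"

lemma GF_0 [simp]: "0 \<in> GF k" and GF_1 [simp]: "1 \<in> GF k"
  by (simp_all add: GF_def)

lemma GF_add: "x \<in> GF k \<Longrightarrow> y \<in> GF k \<Longrightarrow> x + y \<in> GF k"
  by (simp add: GF_def)

lemma GF_mult: "x \<in> GF k \<Longrightarrow> y \<in> GF k \<Longrightarrow> x * y \<in> GF k"
  by (simp add: GF_def power_mult_distrib)

lemma GF_power: "x \<in> GF k \<Longrightarrow> x ^ n \<in> GF k"
  by (induction n) (auto intro: GF_mult)

lemma GF_inverse: "x \<in> GF k \<Longrightarrow> inverse x \<in> GF k"
  by (simp add: GF_def power_inverse)

lemma GF_fixed: "x \<in> GF k \<Longrightarrow> x ^ 2 ^ (k * j) = x"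
  by (induction j) (auto simp: GF_def power_add power_mult)

lemma GF_mono: "x \<in> GF k \<Longrightarrow> x \<in> GF (k * j)"
  using GF_fixed by (simp add: GF_def)

text \<open>The polynomial \<open>X ^ 2 ^ k - X\<close> splits and has derivative \<open>-1\<close>, so its roots are simple.\<close>

lemma card_GF:
  assumes "k > 0"
  shows "finite (GF k) \<and> card (GF k) = 2 ^ k"
proof -
  define p :: "gf poly" where "p = monom 1 (2 ^ k) + monom 1 1"
  have k2: "(1::nat) < 2 ^ k" using assms one_less_power[of "2::nat" k] by simp
  have deg: "degree p = 2 ^ k"
    unfolding p_def using k2 by (subst degree_add_eq_left) (auto simp: degree_monom_eq)
  have p0: "p \<noteq> 0" using deg k2 by force
  have GF: "GF k = {x. poly p x = 0}"
    by (auto simp: p_def poly_monom GF_def gf_add_eq_0_iff)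
  obtain A where A: "size A = degree p" "p = smult (lead_coeff p) (\<Prod>x\<in>#A. [:-x, 1:])"
    using alg_closed_imp_factorization[OF p0] by blast
  have d: "poly (pderiv p) x = 1" for x
  proof -
    have "of_nat (2 ^ k) = (0::gf)" using assms by (simp only: of_nat_eq_0_iff_char_dvd) auto
    then have "pderiv p = 1"
      by (simp add: p_def pderiv_add pderiv_monom flip: monom_0 one_pCons)
    then show ?thesis by simp
  qed
  have lc: "lead_coeff p \<noteq> 0" using p0 by simp
  have roots: "{x. poly p x = 0} = set_mset A"
  proof -
    have "poly p x = lead_coeff p * (\<Prod>y\<in>#A. y + x)" for x
      by (subst A(2)) (simp add: poly_prod_mset image_mset.compositionality o_def)
    then show ?thesis using lc by (auto simp: gf_add_eq_0_iff prod_mset_zero_iff)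
  qed
  have cnt: "count A x = 1" if x: "x \<in># A" for x
  proof (rule ccontr)
    assume "count A x \<noteq> 1"
    obtain B where B: "A = add_mset x B" using multi_member_split[OF x] by blast
    have "x \<in># B" using \<open>count A x \<noteq> 1\<close> unfolding B by (auto simp: not_in_iff)
    then obtain C where C: "B = add_mset x C" by (blast dest: multi_member_split)
    have "p = [:-x,1:] * ([:-x,1:] * smult (lead_coeff p) (\<Prod>x\<in>#C. [:-x, 1:]))"
      by (subst A(2)) (simp add: B C)
    then obtain q where "p = [:-x,1:] * ([:-x,1:] * q)" by blast
    moreover have "poly [:-x,1:] x = 0" by simp
    ultimately have "poly (pderiv p) x = 0"
      by (simp only: pderiv_mult poly_add poly_mult) simp
    then show False using d by simp
  qed
  have "size A = card (set_mset A)"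
    by (simp add: size_multiset_overloaded_eq cnt)
  then show ?thesis using GF roots A(1) deg by simp
qed

subsection \<open>Relative traces and additive characters\<close>

text \<open>On \<open>GF (s * t)\<close> the following function is the trace to the subfield \<open>GF s\<close>.\<close>

definition rtr :: "nat \<Rightarrow> nat \<Rightarrow> gf \<Rightarrow> gf" where
  "rtr s t x = (\<Sum>i<t. x ^ 2 ^ (s * i))"

lemma rtr_0 [simp]: "rtr s t 0 = 0"
  by (simp add: rtr_def power_0_left)

lemma rtr_add: "rtr s t (x + y) = rtr s t x + rtr s t y"
  by (simp add: rtr_def sum.distrib)

lemma rtr_scale: "c \<in> GF s \<Longrightarrow> rtr s t (c * x) = c * rtr s t x"
  by (simp add: rtr_def power_mult_distrib GF_fixed sum_distrib_left)

lemma rtr_power: "rtr s t (x ^ 2 ^ j) = rtr s t x ^ 2 ^ j"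
  by (simp add: rtr_def gf_sum_power mult.commute flip: power_mult)

text \<open>Frobenius shifts the summands by one place, so equal terms cancel in characteristic two.
  The identity holds on the whole closure, which \<open>trace_kernel_iff\<close> exploits for
  elements outside \<open>GF (s * t)\<close>.\<close>

lemma rtr_telescope: "rtr s t (x ^ 2 ^ s) + rtr s t x = x ^ 2 ^ (s * t) + x"
proof (induction t)
  case 0
  then show ?case by (simp add: rtr_def)
next
  case (Suc t)
  have "rtr s (Suc t) (x ^ 2 ^ s) + rtr s (Suc t) x =
      (rtr s t (x ^ 2 ^ s) + rtr s t x) + (x ^ 2 ^ (s * t) + x ^ 2 ^ (s * Suc t))"
    by (simp add: rtr_def algebra_simps power_add flip: power_mult)
  then show ?case unfolding Suc.IH by (simp add: add_ac)
qed

lemma rtr_in_GF: "x \<in> GF (s * t) \<Longrightarrow> rtr s t x \<in> GF s"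
  using rtr_telescope[of s t x] rtr_power[of s t x s] by (simp add: GF_def gf_add_eq_0_iff)

lemma rtr_add_index: "rtr s (m + n) x = rtr s m x + rtr s n (x ^ 2 ^ (s * m))"
  by (induction n) (simp_all add: rtr_def algebra_simps power_add flip: power_mult)

text \<open>Transitivity of the trace: the indices below \<open>a * t\<close> split into
  \<open>t\<close> runs of length \<open>a\<close>.\<close>

lemma rtr_rtr: "rtr s a (rtr (s * a) t x) = rtr s (a * t) x"
proof (induction t)
  case 0
  then show ?case by (simp add: rtr_def[of _ 0])
next
  case (Suc t)
  have "rtr (s * a) (Suc t) x = rtr (s * a) t x + x ^ 2 ^ (s * (a * t))"
    by (simp add: rtr_def mult.assoc)
  moreover have "rtr s (a * Suc t) x = rtr s (a * t) x + rtr s a (x ^ 2 ^ (s * (a * t)))"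
    using rtr_add_index[of s "a * t" a x] by (simp add: add.commute)
  ultimately show ?case using Suc by (simp add: rtr_add)
qed

text \<open>The trace is a polynomial of degree at most \<open>2 ^ (s * (t - 1))\<close>, nonzero
  because its linear coefficient is 1. The root count yields nondegeneracy of the trace form and
  bounds the support in the final dependency.\<close>

lemma card_rtr_kernel:
  assumes "s > 0" "t > 0"
  shows "finite {x. rtr s t x = 0} \<and> card {x. rtr s t x = 0} \<le> 2 ^ (s * (t - 1))"
proof -
  define p :: "gf poly" where "p = (\<Sum>i<t. monom 1 (2 ^ (s * i)))"
  have "coeff p 1 = (\<Sum>i<t. if i = 0 then 1 else 0)"
    unfolding p_def coeff_sum using assms by (intro sum.cong) auto
  also have "\<dots> = 1" using assms by simp
  finally have p0: "p \<noteq> 0" by auto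
  have "degree (monom (1::gf) (2 ^ (s * i))) \<le> 2 ^ (s * (t - 1))" if "i < t" for i
    by (rule order_trans[OF degree_monom_le]) (use that in \<open>auto intro!: power_increasing mult_left_mono\<close>)
  then have deg: "degree p \<le> 2 ^ (s * (t - 1))"
    unfolding p_def by (intro degree_sum_le) auto
  have "{x. rtr s t x = 0} = {x. poly p x = 0}"
    by (simp add: p_def poly_sum poly_monom rtr_def)
  then show ?thesis
    using poly_roots_finite[OF p0] card_poly_roots_bound[OF p0] deg by simp
qed

text \<open>The multiples of \<open>y\<close> exhaust \<open>GF k\<close>, and a polynomial of
  degree \<open>2 ^ (k - 1)\<close> cannot vanish on all of it.\<close>

lemma trace_nondegenerate:
  assumes "k > 0" "y \<in> GF k" "y \<noteq> 0"
  obtains u where "u \<in> GF k" "rtr 1 k (u * y) \<noteq> 0"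
proof (rule ccontr)
  assume "\<not> thesis"
  with that have 0: "rtr 1 k (u * y) = 0" if "u \<in> GF k" for u using that by blast
  have "GF k \<subseteq> {x. rtr 1 k x = 0}"
  proof
    fix v assume "v \<in> GF k"
    then have "rtr 1 k ((v * inverse y) * y) = 0"
      by (intro 0 GF_mult GF_inverse assms)
    then show "v \<in> {x. rtr 1 k x = 0}" using assms(3) by (simp add: mult.assoc)
  qed
  from card_mono[OF _ this] have "card (GF k) \<le> 2 ^ (k - 1)"
    using card_rtr_kernel[of 1 k] assms(1) by force
  then show False using card_GF[OF assms(1)] assms(1) by simp
qed

text \<open>On \<open>GF k\<close> the absolute trace is 0 or 1, so there this is the real additive
  character (-1) ^ Tr.\<close>

definition chr :: "nat \<Rightarrow> gf \<Rightarrow> real" where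
  "chr k x = (if rtr 1 k x = 0 then 1 else -1)"

lemma chr_0 [simp]: "chr k 0 = 1"
  by (simp add: chr_def)

lemma chr_square [simp]: "chr k x * chr k x = 1"
  by (simp add: chr_def)

lemma GF_one: "GF 1 = {0, 1}"
proof -
  have "x ^ 2 = x \<longleftrightarrow> x = 0 \<or> x = 1" for x :: gf
    by (simp add: power2_eq_square)
  then show ?thesis by (auto simp: GF_def)
qed

lemma chr_add:
  assumes "x \<in> GF k" "y \<in> GF k"
  shows "chr k (x + y) = chr k x * chr k y"
proof -
  have "rtr 1 k x \<in> {0, 1}" "rtr 1 k y \<in> {0, 1}"
    using assms rtr_in_GF[of _ 1 k] GF_one by auto
  then show ?thesis by (auto simp: chr_def rtr_add)
qed

text \<open>Translation by \<open>v\<close> is an involution of \<open>H\<close> in characteristic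
  two and reverses the sign of the sum.\<close>

lemma sum_nontrivial_character:
  fixes \<chi> :: "gf \<Rightarrow> real"
  assumes "\<And>u. u \<in> H \<Longrightarrow> u + v \<in> H" "\<And>u. u \<in> H \<Longrightarrow> \<chi> (u + v) = - \<chi> u"
  shows "(\<Sum>u\<in>H. \<chi> u) = 0"
proof -
  have "(\<Sum>u\<in>H. \<chi> u) = (\<Sum>u\<in>H. \<chi> (u + v))"
    by (rule sum.reindex_bij_witness[of _ "\<lambda>u. u + v" "\<lambda>u. u + v"])
      (auto simp: assms(1) add.assoc)
  then show ?thesis using assms(2) by (simp add: sum_negf)
qed

lemma sum_chr_mult:
  assumes "k > 0" "y \<in> GF k"
  shows "(\<Sum>u\<in>GF k. chr k (u * y)) = (if y = 0 then 2 ^ k else 0)"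
proof (cases "y = 0")
  case True
  then show ?thesis using card_GF[OF assms(1)] by simp
next
  case False
  obtain v where v: "v \<in> GF k" "rtr 1 k (v * y) \<noteq> 0"
    using trace_nondegenerate[OF assms False] .
  have "(\<Sum>u\<in>GF k. chr k (u * y)) = 0"
    by (rule sum_nontrivial_character[of _ v])
      (use v assms in \<open>auto simp: GF_add GF_mult chr_add distrib_right chr_def[of k "v * y"]\<close>)
  then show ?thesis using False by simp
qed

lemma GF_conj_conj:
  assumes "x \<in> GF (k * 2)"
  shows "(x ^ 2 ^ k) ^ 2 ^ k = x"
proof -
  have "(2::nat) ^ (k * 2) = 2 ^ k * 2 ^ k"
    by (simp only: power_mult power2_eq_square)
  then show ?thesis using assms by (simp add: GF_def flip: power_mult)
qed

lemma norm_in_GF: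
  assumes "x \<in> GF (k * 2)"
  shows "x * x ^ 2 ^ k \<in> GF k"
  using GF_conj_conj[OF assms] by (simp add: GF_def[of k] power_mult_distrib mult.commute)

lemma rtr_2: "rtr k 2 x = x + x ^ 2 ^ k"
proof -
  have "{..<2::nat} = {0, 1}" by auto
  then show ?thesis by (simp add: rtr_def)
qed

lemma rel_trace_in_GF: "x \<in> GF (k * 2) \<Longrightarrow> x + x ^ 2 ^ k \<in> GF k"
  using rtr_in_GF[of x k 2] by (simp add: rtr_2)

lemma chr_double: "chr (k * 2) x = chr k (x + x ^ 2 ^ k)"
  using rtr_rtr[of 1 k 2 x] by (simp add: chr_def rtr_2)

subsection \<open>Quadratic phases and Gauss sums\<close>

definition phase :: "nat \<Rightarrow> gf \<Rightarrow> gf \<Rightarrow> gf \<Rightarrow> real" where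
  "phase k a w x = chr k (a * (x * x ^ 2 ^ k)) * chr (k * 2) (w * x)"

lemma phase_square [simp]: "phase k a w x * phase k a w x = 1"
  by (simp add: phase_def mult.left_commute mult.assoc)

lemma abs_phase [simp]: "\<bar>phase k a w x\<bar> = 1"
  by (simp add: phase_def chr_def)

lemma phase_mult:
  assumes "a \<in> GF k" "a' \<in> GF k" "w \<in> GF (k * 2)" "w' \<in> GF (k * 2)" "x \<in> GF (k * 2)"
  shows "phase k a w x * phase k a' w' x = phase k (a + a') (w + w') x"
  using assms by (simp add: phase_def distrib_right chr_add GF_mult norm_in_GF)

text \<open>Polarisation of the norm form: as a function of \<open>x\<close>, the product of the
  values at \<open>x\<close> and \<open>x + h\<close> is a constant times a linear
  character.\<close>

lemma phase_shift:
  assumes c: "c \<in> GF k" and w: "w \<in> GF (k * 2)" and x: "x \<in> GF (k * 2)" and h: "h \<in> GF (k * 2)"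
  shows "phase k c w x * phase k c w (x + h) = phase k c w h * chr (k * 2) (x * (c * h ^ 2 ^ k))"
proof -
  define z where "z = x * (c * h ^ 2 ^ k)"
  have cc: "c ^ 2 ^ k = c" using c by (simp add: GF_def)
  have hh: "(h ^ 2 ^ k) ^ 2 ^ k = h" using GF_conj_conj[OF h] .
  have c2: "c \<in> GF (k * 2)" using c by (rule GF_mono)
  have z: "z \<in> GF (k * 2)" unfolding z_def using x h c2 by (intro GF_mult GF_power)
  have Nx: "c * (x * x ^ 2 ^ k) \<in> GF k" and Nh: "c * (h * h ^ 2 ^ k) \<in> GF k"
    using c x h by (auto intro!: GF_mult[of c] norm_in_GF)
  \<comment> \<open>The two mixed terms are conjugate over \<open>GF k\<close>, so
    \<open>chr_double\<close> merges them into one character value of the large field.\<close>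
  have "c * ((x + h) * (x + h) ^ 2 ^ k) =
      (c * (x * x ^ 2 ^ k) + c * (h * h ^ 2 ^ k)) + (z + z ^ 2 ^ k)"
    by (simp add: z_def power_mult_distrib cc hh algebra_simps)
  then have "chr k (c * ((x + h) * (x + h) ^ 2 ^ k)) =
      chr k (c * (x * x ^ 2 ^ k)) * chr k (c * (h * h ^ 2 ^ k)) * chr (k * 2) z"
    using chr_add[OF GF_add[OF Nx Nh] rel_trace_in_GF[OF z]] chr_add[OF Nx Nh]
    by (simp add: chr_double)
  moreover have "chr (k * 2) (w * (x + h)) = chr (k * 2) (w * x) * chr (k * 2) (w * h)"
    using w x h by (simp add: distrib_left chr_add GF_mult)
  ultimately have "phase k c w (x + h) = phase k c w x * (phase k c w h * chr (k * 2) z)"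
    by (simp add: phase_def)
  then have "phase k c w x * phase k c w (x + h) =
      (phase k c w x * phase k c w x) * (phase k c w h * chr (k * 2) z)"
    by (simp only: mult.assoc)
  then show ?thesis by (simp add: z_def)
qed

text \<open>Square the sum and put \<open>y = x + h\<close>: by \<open>phase_shift\<close> the sum
  over \<open>x\<close> becomes a linear character sum, which vanishes unless \<open>h = 0\<close>
  because \<open>c \<noteq> 0\<close>.\<close>

lemma abs_gauss_sum:
  assumes "k > 0" "c \<in> GF k" "c \<noteq> 0" "w \<in> GF (k * 2)"
  shows "\<bar>\<Sum>x\<in>GF (k * 2). phase k c w x\<bar> = 2 ^ k"
proof -
  let ?E = "GF (k * 2)" and ?f = "phase k c w"
  have fin: "finite ?E" using card_GF[of "k * 2"] assms(1) by simp
  have "(\<Sum>x\<in>?E. ?f x)\<^sup>2 = (\<Sum>x\<in>?E. \<Sum>y\<in>?E. ?f x * ?f y)"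
    by (simp add: power2_eq_square sum_product)
  also have "\<dots> = (\<Sum>x\<in>?E. \<Sum>h\<in>?E. ?f x * ?f (x + h))"
  proof (rule sum.cong[OF refl])
    fix x assume "x \<in> ?E"
    then show "(\<Sum>y\<in>?E. ?f x * ?f y) = (\<Sum>h\<in>?E. ?f x * ?f (x + h))"
      by (intro sum.reindex_bij_witness[of _ "\<lambda>h. x + h" "\<lambda>h. x + h"]) (auto intro: GF_add)
  qed
  also have "\<dots> = (\<Sum>x\<in>?E. \<Sum>h\<in>?E. ?f h * chr (k * 2) (x * (c * h ^ 2 ^ k)))"
    using assms by (intro sum.cong refl phase_shift)
  also have "\<dots> = (\<Sum>h\<in>?E. ?f h * (\<Sum>x\<in>?E. chr (k * 2) (x * (c * h ^ 2 ^ k))))"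
    by (subst sum.swap) (simp add: sum_distrib_left)
  also have "\<dots> = (\<Sum>h\<in>?E. if h = 0 then 2 ^ (k * 2) else 0)"
  proof (rule sum.cong[OF refl])
    fix h assume "h \<in> ?E"
    then have "c * h ^ 2 ^ k \<in> ?E" using assms by (intro GF_mult GF_power) (auto intro: GF_mono)
    then show "?f h * (\<Sum>x\<in>?E. chr (k * 2) (x * (c * h ^ 2 ^ k))) = (if h = 0 then 2 ^ (k * 2) else 0)"
      using assms by (subst sum_chr_mult) (auto simp: phase_def)
  qed
  also have "\<dots> = (2 ^ k)\<^sup>2" using fin by (simp add: power_mult)
  finally have "\<bar>\<Sum>x\<in>?E. ?f x\<bar>\<^sup>2 = (2 ^ k)\<^sup>2" by (simp only: power2_abs)
  then show ?thesis by (rule power2_eq_imp_eq) auto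
qed

lemma sum_phase_linear:
  assumes "k > 0" "w \<in> GF (k * 2)"
  shows "(\<Sum>x\<in>GF (k * 2). phase k 0 w x) = (if w = 0 then 2 ^ (k * 2) else 0)"
  using sum_chr_mult[of "k * 2" w] assms by (simp add: phase_def mult.commute)

subsection \<open>The kernel of the trace\<close>

definition trace_kernel :: "nat \<Rightarrow> nat \<Rightarrow> gf set" where
  "trace_kernel r t = {u \<in> GF (r * t). rtr r t u = 0}"

lemma sum_chr_subfield:
  assumes "r > 0" "y \<in> GF (r * t)"
  shows "(\<Sum>a\<in>GF r. chr (r * t) (a * y)) = (if rtr r t y = 0 then 2 ^ r else 0)"
proof -
  have "chr (r * t) (a * y) = chr r (a * rtr r t y)" if "a \<in> GF r" for a
    using rtr_rtr[of 1 r t "a * y"] rtr_scale[OF that, of t y] by (simp add: chr_def)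
  then show ?thesis using sum_chr_mult[OF assms(1) rtr_in_GF[OF assms(2)]] by simp
qed

lemma rtr_Frobenius:
  assumes "z \<in> GF k"
  shows "rtr 1 k (z ^ 2 ^ r) = rtr 1 k z"
  using GF_fixed[of "rtr 1 k z" 1 r] rtr_in_GF[of z 1 k] assms by (simp add: rtr_power)

text \<open>\<open>GF r\<close> is the annihilator of the trace kernel under the trace form. For
  \<open>y\<close> outside \<open>GF r\<close>, an element of the form \<open>u ^ 2 ^ r + u\<close>,
  as in additive Hilbert 90, lies in the kernel and pairs nontrivially with
  \<open>y\<close>.\<close>

lemma sum_chr_trace_kernel:
  assumes "r > 0" "t > 0" "y \<in> GF (r * t)"
  shows "(\<Sum>u\<in>trace_kernel r t. chr (r * t) (u * y)) =
    (if y \<in> GF r then real (card (trace_kernel r t)) else 0)"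
proof (cases "y \<in> GF r")
  case True
  have "chr (r * t) (u * y) = 1" if "u \<in> trace_kernel r t" for u
    using rtr_rtr[of 1 r t "y * u"] rtr_scale[OF True, of t u] that
    by (simp add: chr_def trace_kernel_def mult.commute)
  then show ?thesis using True by simp
next
  case False
  let ?k = "r * t"
  have k: "?k > 0" using assms by simp
  have yq: "y ^ 2 ^ r \<in> GF ?k" using assms by (intro GF_power)
  have "y + y ^ 2 ^ r \<noteq> 0" using False by (auto simp: GF_def gf_add_eq_0_iff)
  then obtain v where v: "v \<in> GF ?k" "rtr 1 ?k (v * (y + y ^ 2 ^ r)) \<noteq> 0"
    using trace_nondegenerate[OF k GF_add[OF assms(3) yq]] by blast
  \<comment> \<open>This power inverts the map raising to \<open>2 ^ r\<close> on
    \<open>GF (r * t)\<close>.\<close>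
  define u where "u = v ^ 2 ^ (r * (t - 1))"
  have u: "u \<in> GF ?k" unfolding u_def using v by (intro GF_power)
  have "u ^ 2 ^ r = v ^ 2 ^ (r * (t - 1) + r)"
    by (simp add: u_def power_add flip: power_mult)
  also have "r * (t - 1) + r = ?k" using assms(2) by (cases t) auto
  finally have uv: "u ^ 2 ^ r = v" using v by (simp add: GF_def)
  define w where "w = v + u"
  have w: "w \<in> trace_kernel r t"
    using rtr_telescope[of r t u] u v
    by (simp add: trace_kernel_def w_def rtr_add uv GF_add) (simp add: GF_def)
  \<comment> \<open>Frobenius invariance replaces \<open>u * y\<close> by
    \<open>v * y ^ 2 ^ r\<close>, which produces the factor \<open>y + y ^ 2 ^ r\<close> for which
    \<open>v\<close> was chosen.\<close>
  have "rtr 1 ?k (w * y) = rtr 1 ?k (v * y) + rtr 1 ?k ((u * y) ^ 2 ^ r)"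
    using rtr_Frobenius[OF GF_mult[OF u assms(3)]] by (simp add: w_def distrib_right rtr_add)
  also have "\<dots> = rtr 1 ?k (v * (y + y ^ 2 ^ r))"
    by (simp add: power_mult_distrib uv distrib_left rtr_add)
  finally have "chr ?k (w * y) = -1" using v by (simp add: chr_def)
  then have "(\<Sum>u\<in>trace_kernel r t. chr ?k (u * y)) = 0"
    using w assms(3)
    by (intro sum_nontrivial_character[of _ w])
      (auto simp: trace_kernel_def GF_add rtr_add distrib_right chr_add GF_mult)
  then show ?thesis using False by simp
qed

text \<open>
  The quadratic form \<open>x \<mapsto> rtr r t (x * x ^ 2 ^ (r * t))\<close> is anisotropic on the quotient of
  \<open>{x. x + x ^ 2 ^ (r * t) \<in> GF r}\<close>, the orthogonal space of the kernel of the trace, by that kernel.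
\<close>

lemma trace_kernel_iff:
  assumes "r > 0" "t > 0" "x \<in> GF (r * t * 2)"
  shows "x + x ^ 2 ^ (r * t) \<in> GF r \<and> rtr r t (x * x ^ 2 ^ (r * t)) = 0 \<longleftrightarrow> x \<in> trace_kernel r t"
    (is "?c \<in> _ \<and> _ \<longleftrightarrow> _")
proof
  let ?m = "2 ^ (r * t) :: nat"
  have sq: "rtr r t (x * x) = rtr r t x ^ 2" for x
    using rtr_power[of r t x 1] by (simp add: power2_eq_square)
  {
    assume "x \<in> trace_kernel r t"
    then show "?c \<in> GF r \<and> rtr r t (x * x ^ ?m) = 0"
      by (simp add: trace_kernel_def GF_def[of "r * t"] sq)
  next
    assume asm: "?c \<in> GF r \<and> rtr r t (x * x ^ ?m) = 0"
    show "x \<in> trace_kernel r t"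
    proof (cases "?c = 0")
      case True
      \<comment> \<open>Here \<open>x\<close> lies in \<open>GF (r * t)\<close> and its norm is its
        square.\<close>
      then have "x ^ ?m = x" by (simp add: gf_add_eq_0_iff)
      then show ?thesis using asm by (simp add: trace_kernel_def GF_def sq)
    next
      case False
      \<comment> \<open>Scaling by an element of \<open>GF r\<close> keeps the quadratic form zero
        and normalises the relative trace to 1.\<close>
      define d where "d = inverse ?c"
      have d: "d \<in> GF r" using asm unfolding d_def by (blast intro: GF_inverse)
      define z where "z = d * x"
      have zm: "z ^ ?m = d * x ^ ?m"
        using GF_fixed[OF d, of t] by (simp add: z_def power_mult_distrib)
      have "z + z ^ ?m = d * ?c" unfolding zm by (simp add: z_def distrib_left)
      then have z1: "z + z ^ ?m = 1" using False by (simp add: d_def)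
      have "z * z ^ ?m = d * (d * (x * x ^ ?m))" unfolding zm by (simp add: z_def)
      then have "rtr r t (z * z ^ ?m) = 0" using asm by (simp add: rtr_scale[OF d])
      moreover have "z * z ^ ?m = z * z + z"
        using z1 by (metis distrib_left gf_add_left_cancel mult_1_right add.commute)
      ultimately have "rtr r t z ^ 2 = rtr r t z"
        by (simp add: rtr_add sq gf_add_eq_0_iff)
      \<comment> \<open>Being fixed by squaring, the value is also fixed by the
        \<open>r\<close>-fold Frobenius; telescoping then gives \<open>z ^ ?m = z\<close>,
        contradicting \<open>z1\<close>.\<close>
      then have "rtr r t z ^ 2 ^ r = rtr r t z"
        using GF_fixed[of "rtr r t z" 1 r] by (simp add: GF_def)
      then have "z ^ ?m + z = 0" using rtr_telescope[of r t z] by (simp add: rtr_power)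
      then show ?thesis using z1 by (simp add: add.commute)
    qed
  }
qed

text \<open>For \<open>w\<close> in the trace kernel, the linear phase depends only on the relative
  trace of \<open>x\<close>, so the double sum factors. The two factors test the two conditions of
  \<open>trace_kernel_iff\<close>.\<close>

lemma sum_phase_trace_kernel:
  assumes "r > 0" "t > 0" "x \<in> GF (r * t * 2)"
  shows "(\<Sum>a\<in>GF r. \<Sum>w\<in>trace_kernel r t. phase (r * t) a w x) =
    (if x \<in> trace_kernel r t then 2 ^ r * real (card (trace_kernel r t)) else 0)"
proof -
  let ?m = "2 ^ (r * t) :: nat"
  have "chr (r * t * 2) (w * x) = chr (r * t) (w * (x + x ^ ?m))" if "w \<in> trace_kernel r t" for w
    using that by (simp add: chr_double trace_kernel_def GF_def power_mult_distrib distrib_left)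
  then have "(\<Sum>a\<in>GF r. \<Sum>w\<in>trace_kernel r t. phase (r * t) a w x) =
      (\<Sum>a\<in>GF r. chr (r * t) (a * (x * x ^ ?m))) *
      (\<Sum>w\<in>trace_kernel r t. chr (r * t) (w * (x + x ^ ?m)))"
    by (simp add: phase_def sum_product)
  also have "\<dots> = (if x \<in> trace_kernel r t then 2 ^ r * real (card (trace_kernel r t)) else 0)"
    unfolding sum_chr_subfield[OF assms(1) norm_in_GF[OF assms(3)]]
      sum_chr_trace_kernel[OF assms(1,2) rel_trace_in_GF[OF assms(3)]]
    using trace_kernel_iff[OF assms] by auto
  finally show ?thesis .
qed

lemma card_trace_kernel:
  assumes "r > 0" "t > 0"
  shows "finite (trace_kernel r t)" "card (trace_kernel r t) \<le> 2 ^ (r * (t - 1))"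
proof -
  have sub: "trace_kernel r t \<subseteq> {x. rtr r t x = 0}" by (auto simp: trace_kernel_def)
  then show "finite (trace_kernel r t)"
    using card_rtr_kernel[OF assms] finite_subset by blast
  show "card (trace_kernel r t) \<le> 2 ^ (r * (t - 1))"
    using card_rtr_kernel[OF assms] card_mono[OF _ sub] by simp
qed

lemma trace_kernel_0 [simp]: "0 \<in> trace_kernel r t"
  by (simp add: trace_kernel_def)

lemma trace_kernel_subset: "trace_kernel r t \<subseteq> GF (r * t * 2)"
  by (auto simp: trace_kernel_def intro: GF_mono)

subsection \<open>Unions of orthonormal bases\<close>

text \<open>The Gram identity makes the determinant of the square matrix of the vectors nonzero, and
  \<open>n\<close> independent vectors form a basis.\<close>

lemma orthonormal_family_basis:
  fixes b :: "nat \<Rightarrow> real vec"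
  assumes b: "\<And>l. l < n \<Longrightarrow> b l \<in> carrier_vec n"
    and orth: "\<And>l l'. l < n \<Longrightarrow> l' < n \<Longrightarrow> b l \<bullet> b l' = (if l = l' then 1 else 0)"
  shows "inj_on b {..<n}" "orthonormal_basis n (b ` {..<n})"
proof -
  interpret vec_space "TYPE(real)" n .
  show inj: "inj_on b {..<n}"
    by (rule inj_onI) (metis lessThan_iff orth zero_neq_one)
  define A where "A = mat_of_cols n (map b [0..<n])"
  have A: "A \<in> carrier_mat n n" by (simp add: A_def mat_of_cols_def)
  have colA: "col A l = b l" if "l < n" for l
    using that b by (simp add: A_def)
  have "A\<^sup>T * A = 1\<^sub>m n"
    using A by (intro eq_matI) (auto simp: colA orth)
  then have "det A\<^sup>T * det A = 1"
    using A by (metis det_mult det_one transpose_carrier_mat)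
  then have "det A \<noteq> 0" by auto
  moreover have cols: "set (cols A) = b ` {..<n}"
    using A by (auto simp: cols_def colA)
  ultimately have "lin_indpt (b ` {..<n})"
    using lin_dep_cols_imp_det_0[OF A] by auto
  then have "basis (b ` {..<n})"
    using b by (intro dim_li_is_basis) (auto simp: dim_is_n card_image[OF inj])
  then show "orthonormal_basis n (b ` {..<n})"
    unfolding orthonormal_basis_def using orth inj by (auto simp: inj_on_eq_iff)
qed

lemma sum_blocks:
  fixes f :: "nat \<Rightarrow> 'a :: comm_monoid_add"
  shows "(\<Sum>j<k * n. f j) = (\<Sum>i<k. \<Sum>l<n. f (i * n + l))"
proof -
  have "sum f {i * n..<i * n + n} = (\<Sum>l<n. f (i * n + l))" for i
    using sum.atLeastLessThan_shift_0[of f "i * n" "i * n + n"] by (simp add: atLeast0LessThan add.commute)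
  then show ?thesis using sum.nat_group[of f n k] by simp
qed

lemma block_div_mod:
  fixes i l n k :: nat
  assumes "i < k" "l < n"
  shows "i * n + l < k * n" "(i * n + l) div n = i" "(i * n + l) mod n = l"
proof -
  have "i * n + l < Suc i * n" using assms by simp
  also have "\<dots> \<le> k * n" using assms by (intro mult_le_mono1) simp
  finally show "i * n + l < k * n" .
qed (use assms in auto)

text \<open>
  For \<open>u = s * \<mu>\<close> the hypothesis reads \<open>a \<le> A * u / (1 + u)\<close>; the concave right-hand side is
  bounded by its tangent at \<open>u = 1 / q\<close>, where all blocks are balanced.
\<close>

lemma balanced_blocks_bound:
  fixes a s :: "nat \<Rightarrow> real"
  assumes q: "q > 0" and \<mu>: "\<mu> \<ge> 0" and pos: "(\<Sum>i<q + 1. a i) > 0"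
    and s: "\<And>i. i < q + 1 \<Longrightarrow> s i \<ge> 0"
    and le: "\<And>i. i < q + 1 \<Longrightarrow> a i \<le> s i * (\<mu> * ((\<Sum>i<q + 1. a i) - a i))"
  shows "real q + 1 \<le> real q * \<mu> * (\<Sum>i<q + 1. s i)"
proof -
  define A where "A = (\<Sum>i<q + 1. a i)"
  have A: "A > 0" using pos by (simp add: A_def)
  have tangent: "(real q + 1)\<^sup>2 * a i \<le> A * (1 + (real q)\<^sup>2 * (\<mu> * s i))" if "i < q + 1" for i
  proof -
    define u where "u = \<mu> * s i"
    have u: "u \<ge> 0" using \<mu> s[OF that] by (simp add: u_def)
    have 1: "a i * (1 + u) \<le> A * u"
      using le[OF that] by (simp add: u_def A_def algebra_simps)
    have "(1 + u) * ((real q + 1)\<^sup>2 * a i) = (real q + 1)\<^sup>2 * (a i * (1 + u))"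
      by (simp add: mult_ac)
    also have "\<dots> \<le> (real q + 1)\<^sup>2 * (A * u)"
      using 1 by (intro mult_left_mono) auto
    \<comment> \<open>Up to the factor \<open>A\<close>, the added square is the gap to the tangent:
      \<open>(1 + u) * (1 + q\<^sup>2 * u) - (q + 1)\<^sup>2 * u = (1 - q *
      u)\<^sup>2\<close>.\<close>
    also have "\<dots> \<le> (real q + 1)\<^sup>2 * (A * u) + A * (1 - real q * u)\<^sup>2"
      using A by simp
    also have "\<dots> = (1 + u) * (A * (1 + (real q)\<^sup>2 * u))"
      by (simp add: power2_eq_square algebra_simps)
    finally show ?thesis using u unfolding u_def[symmetric]
      by (simp add: mult_le_cancel_left_pos)
  qed
  have "(real q + 1)\<^sup>2 * A = (\<Sum>i<q + 1. (real q + 1)\<^sup>2 * a i)"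
    by (simp add: A_def sum_distrib_left del: sum.lessThan_Suc)
  also have "\<dots> \<le> (\<Sum>i<q + 1. A * (1 + (real q)\<^sup>2 * (\<mu> * s i)))"
    using tangent by (intro sum_mono) auto
  also have "\<dots> = A * ((real q + 1) + (real q)\<^sup>2 * (\<mu> * (\<Sum>i<q + 1. s i)))"
    by (simp add: sum.distrib sum_distrib_left flip: sum_distrib_left del: sum.lessThan_Suc)
  finally have "(real q + 1)\<^sup>2 \<le> (real q + 1) + (real q)\<^sup>2 * (\<mu> * (\<Sum>i<q + 1. s i))"
    using A by (simp add: mult.commute[of _ A] del: sum.lessThan_Suc)
  then have "real q * (real q + 1) \<le> real q * (real q * \<mu> * (\<Sum>i<q + 1. s i))"
    by (simp add: power2_eq_square algebra_simps del: sum.lessThan_Suc)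
  then show ?thesis using q by (simp del: sum.lessThan_Suc)
qed

text \<open>Separates the linear algebra from the finite fields: \<open>b i l\<close> is vector
  \<open>l\<close> of basis \<open>i\<close>, and it becomes column \<open>i * n + l\<close> of
  \<open>D\<close>.\<close>

locale coherent_bases =
  fixes n k :: nat and \<mu> :: real and b :: "nat \<Rightarrow> nat \<Rightarrow> real vec"
  assumes n_pos: "n > 0"
    and carrier: "\<lbrakk>i < k; l < n\<rbrakk> \<Longrightarrow> b i l \<in> carrier_vec n"
    and orth: "\<lbrakk>i < k; l < n; l' < n\<rbrakk> \<Longrightarrow> b i l \<bullet> b i l' = (if l = l' then 1 else 0)"
    and coh: "\<lbrakk>i < k; i' < k; i \<noteq> i'; l < n; l' < n\<rbrakk> \<Longrightarrow> \<bar>b i l \<bullet> b i' l'\<bar> = \<mu>"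
begin

definition D :: "real mat" where
  "D = mat_of_cols n (map (\<lambda>j. b (j div n) (j mod n)) [0..<k * n])"

lemma D_carrier: "D \<in> carrier_mat n (k * n)"
  by (simp add: D_def mat_of_cols_def)

lemma dim_D [simp]: "dim_row D = n" "dim_col D = k * n"
  using D_carrier by auto

lemma div_less: "j < k * n \<Longrightarrow> j div n < k" and mod_less: "j mod n < n"
  using n_pos by (auto simp: less_mult_imp_div_less)

lemma col_D: "j < k * n \<Longrightarrow> col D j = b (j div n) (j mod n)"
  using carrier[OF div_less mod_less] by (simp add: D_def)

lemma cols_D: "cols D = map (\<lambda>j. b (j div n) (j mod n)) [0..<k * n]"
  by (simp add: cols_def col_D)

lemma union_D: "union_of_orthonormal_bases n k D"
  unfolding union_of_orthonormal_bases_def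
proof (intro exI conjI allI impI)
  fix i assume "i < k"
  then show "orthonormal_basis n (b i ` {..<n})"
    by (intro orthonormal_family_basis) (auto simp: carrier orth)
next
  have "mset_set (b i ` {..<n}) = (\<Sum>l<n. {#b i l#})" if "i < k" for i
  proof -
    have "inj_on (b i) {..<n}"
      using that by (intro orthonormal_family_basis) (auto simp: carrier orth)
    then show ?thesis
      by (simp add: sum_unfold_sum_mset image_mset.compositionality o_def flip: image_mset_mset_set)
  qed
  then have "(\<Sum>i<k. mset_set (b i ` {..<n})) = (\<Sum>i<k. \<Sum>l<n. {#b i l#})"
    by simp
  also have "\<dots> = (\<Sum>j<k * n. {#b (j div n) (j mod n)#})"
    unfolding sum_blocks by (intro sum.cong) (auto simp: block_div_mod)
  also have "\<dots> = mset (cols D)"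
    by (simp add: cols_D sum_unfold_sum_mset lessThan_atLeast0)
  finally show "mset (cols D) = (\<Sum>i<k. mset_set (b i ` {..<n}))" ..
qed

lemma dictionary_D:
  assumes "k > 0"
  shows "dictionary n D"
  unfolding dictionary_def
proof (intro conjI allI impI)
  interpret vec_space "TYPE(real)" n .
  show "dim_row D = n" "n \<le> dim_col D" using assms by auto
  show "sqrt (col D j \<bullet> col D j) = 1" if "j < dim_col D" for j
    using that by (simp add: col_D orth div_less mod_less)
  have sub: "set (cols D) \<subseteq> carrier_vec n"
    using cols_dim[of D] by simp
  have "b 0 ` {..<n} \<subseteq> set (cols D)"
  proof
    fix v assume "v \<in> b 0 ` {..<n}"
    then obtain l where "l < n" "v = b 0 l" by auto
    then show "v \<in> set (cols D)"
      using block_div_mod[of 0 k l n] assms by (auto simp: cols_D intro!: image_eqI[of _ _ l])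
  qed
  then have "span (b 0 ` {..<n}) \<subseteq> span (set (cols D))"
    by (rule span_is_monotone)
  moreover have "span (b 0 ` {..<n}) = carrier_vec n"
    using orthonormal_family_basis(2)[of n "b 0"] carrier orth assms
    by (simp add: orthonormal_basis_def basis_def)
  ultimately show "span (set (cols D)) = carrier_vec n"
    using span_closed[OF sub] by auto
qed

lemma coherence_D:
  assumes "k > 1"
  shows "mutual_coherence D = \<mu>"
  unfolding mutual_coherence_def
proof (rule Max_eqI)
  let ?S = "{\<bar>col D i \<bullet> col D j\<bar> |i j. i < dim_col D \<and> j < dim_col D \<and> i \<noteq> j}"
  have \<mu>: "\<mu> \<ge> 0" using coh[of 0 1 0 0] assms n_pos by auto
  have S: "y = 0 \<or> y = \<mu>" if "y \<in> ?S" for y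
  proof -
    from that obtain i j where ij: "i < k * n" "j < k * n" "i \<noteq> j" "y = \<bar>col D i \<bullet> col D j\<bar>"
      by auto
    show ?thesis
    proof (cases "i div n = j div n")
      case True
      then have "i mod n \<noteq> j mod n" using ij(3) by (metis div_mult_mod_eq)
      then show ?thesis using ij True by (simp add: col_D orth div_less mod_less)
    next
      case False
      then show ?thesis using ij by (simp add: col_D coh div_less mod_less)
    qed
  qed
  then have "?S \<subseteq> {0, \<mu>}" by blast
  then show "finite ?S" by (rule finite_subset) simp
  show "y \<le> \<mu>" if "y \<in> ?S" for y using S[OF that] \<mu> by auto
  \<comment> \<open>Columns 0 and \<open>n\<close> are the first vectors of blocks 0 and 1, so they
    attain the coherence.\<close>
  have "n < k * n" using assms n_pos by simp
  moreover from this have "\<mu> = \<bar>col D 0 \<bullet> col D n\<bar>"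
    using n_pos coh[of 0 1 0 0] assms by (simp add: col_D)
  ultimately show "\<mu> \<in> ?S"
    using n_pos assms by (intro CollectI exI[of _ "0::nat"] exI[of _ n]) simp
qed

lemma l0_norm_blocks:
  assumes "x \<in> carrier_vec (k * n)"
  shows "l0_norm x = (\<Sum>i<k. card {l. l < n \<and> x $ (i * n + l) \<noteq> 0})"
proof -
  have card: "card {j. j < m \<and> P j} = (\<Sum>j<m. if P j then 1 else 0)" for m :: nat and P
    by (simp add: sum.If_cases Int_def)
  have "dim_vec x = k * n" using assms by simp
  then show ?thesis unfolding l0_norm_def card by (simp only: sum_blocks)
qed

section \<open>Support sizes of kernel vectors\<close>

lemma kernel_gram:
  fixes x :: "real vec"
  assumes x: "x \<in> mat_kernel D" and "i < k" "l < n"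
  shows "(\<Sum>i'<k. \<Sum>l'<n. (b i l \<bullet> b i' l') * x $ (i' * n + l')) = 0"
proof -
  let ?j = "i * n + l"
  note dm = block_div_mod[OF assms(2,3)]
  have xc: "x \<in> carrier_vec (k * n)" and x0: "D *\<^sub>v x = 0\<^sub>v n"
    using x mat_kernel[OF D_carrier] by auto
  have "(D\<^sup>T * D) *\<^sub>v x = D\<^sup>T *\<^sub>v (D *\<^sub>v x)"
    using D_carrier xc by (intro assoc_mult_mat_vec) auto
  also have "\<dots> = 0\<^sub>v (k * n)"
    using D_carrier by (auto simp: x0)
  finally have "((D\<^sup>T * D) *\<^sub>v x) $ ?j = 0" using dm by simp
  moreover have "((D\<^sup>T * D) *\<^sub>v x) $ ?j = (\<Sum>j<k * n. (col D ?j \<bullet> col D j) * x $ j)"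
    using D_carrier xc dm
    by (auto simp: scalar_prod_def[of _ x] atLeast0LessThan simp del: assoc_mult_mat_vec intro!: sum.cong)
  also have "\<dots> = (\<Sum>i'<k. \<Sum>l'<n. (b i l \<bullet> b i' l') * x $ (i' * n + l'))"
    unfolding sum_blocks using dm by (intro sum.cong refl) (auto simp: col_D block_div_mod)
  ultimately show ?thesis by simp
qed

text \<open>In row \<open>(i, l)\<close> of the Gram equation the own block contributes just the
  entry itself, by orthonormality; all coefficients from other blocks have absolute value
  \<open>\<mu>\<close>.\<close>

lemma kernel_block_bound:
  fixes x :: "real vec"
  assumes x: "x \<in> mat_kernel D" and il: "i < k" "l < n"
  defines "a \<equiv> \<lambda>i. \<Sum>l<n. \<bar>x $ (i * n + l)\<bar>"
  shows "\<bar>x $ (i * n + l)\<bar> \<le> \<mu> * ((\<Sum>i<k. a i) - a i)"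
proof -
  let ?g = "\<lambda>i'. \<Sum>l'<n. (b i l \<bullet> b i' l') * x $ (i' * n + l')"
  have "?g i = (\<Sum>l'<n. if l' = l then x $ (i * n + l') else 0)"
    using il by (intro sum.cong) (auto simp: orth)
  then have "?g i = x $ (i * n + l)" using il by simp
  moreover have "?g i + (\<Sum>i'\<in>{..<k} - {i}. ?g i') = 0"
    using kernel_gram[OF x il] il by (simp add: sum.remove[of "{..<k}" i ?g])
  ultimately have "\<bar>x $ (i * n + l)\<bar> = \<bar>\<Sum>i'\<in>{..<k} - {i}. ?g i'\<bar>" by linarith
  also have "\<dots> \<le> (\<Sum>i'\<in>{..<k} - {i}. \<bar>?g i'\<bar>)" by (rule sum_abs)
  also have "\<dots> \<le> (\<Sum>i'\<in>{..<k} - {i}. \<mu> * a i')"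
  proof (rule sum_mono)
    fix i' assume i': "i' \<in> {..<k} - {i}"
    have "\<bar>?g i'\<bar> \<le> (\<Sum>l'<n. \<bar>(b i l \<bullet> b i' l') * x $ (i' * n + l')\<bar>)" by (rule sum_abs)
    also have "\<dots> = \<mu> * a i'"
      using il i' by (simp add: a_def abs_mult coh sum_distrib_left)
    finally show "\<bar>?g i'\<bar> \<le> \<mu> * a i'" .
  qed
  also have "\<dots> = \<mu> * ((\<Sum>i<k. a i) - a i)"
    using il by (simp add: sum_diff1 flip: sum_distrib_left)
  finally show ?thesis .
qed

text \<open>Summing the entrywise bound over the support of each block gives the hypothesis of
  \<open>balanced_blocks_bound\<close>, with \<open>a\<close> the l1-norms and \<open>s\<close> the
  support sizes of the blocks.\<close>

lemma kernel_l0_lower_bound: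
  assumes k: "k = q + 1" and q: "q > 0" and \<mu>: "\<mu> \<ge> 0"
    and x: "x \<in> mat_kernel D" "x \<noteq> 0\<^sub>v (k * n)"
  shows "real q + 1 \<le> real q * \<mu> * real (l0_norm x)"
proof -
  define a where "a = (\<lambda>i. \<Sum>l<n. \<bar>x $ (i * n + l)\<bar>)"
  define s where "s = (\<lambda>i. real (card {l. l < n \<and> x $ (i * n + l) \<noteq> 0}))"
  have xc: "x \<in> carrier_vec (k * n)" using x mat_kernel[OF D_carrier] by auto
  have "\<exists>j<k * n. x $ j \<noteq> 0"
    using x(2) xc by (metis carrier_vecD eq_vecI index_zero_vec)
  then have "0 < (\<Sum>j<k * n. \<bar>x $ j\<bar>)"
    by (metis abs_ge_zero finite_lessThan lessThan_iff sum_pos2 zero_less_abs_iff)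
  then have pos: "0 < (\<Sum>i<q + 1. a i)" unfolding sum_blocks k a_def .
  have le: "a i \<le> s i * (\<mu> * ((\<Sum>i<q + 1. a i) - a i))" if "i < q + 1" for i
  proof -
    have "a i = (\<Sum>l\<in>{l. l < n \<and> x $ (i * n + l) \<noteq> 0}. \<bar>x $ (i * n + l)\<bar>)"
      unfolding a_def by (intro sum.mono_neutral_right) auto
    also have "\<dots> \<le> (\<Sum>l\<in>{l. l < n \<and> x $ (i * n + l) \<noteq> 0}. \<mu> * ((\<Sum>i<k. a i) - a i))"
      using that k unfolding a_def by (intro sum_mono kernel_block_bound x(1)) auto
    finally show ?thesis by (simp add: s_def k)
  qed
  have "real q + 1 \<le> real q * \<mu> * (\<Sum>i<q + 1. s i)"
    using q \<mu> pos _ le by (rule balanced_blocks_bound) (simp add: s_def)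
  then show ?thesis by (simp add: l0_norm_blocks[OF xc] s_def k)
qed

lemma kernelI:
  assumes "\<And>c. c < n \<Longrightarrow> (\<Sum>i<k. \<Sum>l<n. b i l $ c * y i l) = 0"
  shows "vec (k * n) (\<lambda>j. y (j div n) (j mod n)) \<in> mat_kernel D"
proof -
  let ?x = "vec (k * n) (\<lambda>j. y (j div n) (j mod n))"
  have "D *\<^sub>v ?x = 0\<^sub>v n"
  proof (rule eq_vecI)
    fix c assume "c < dim_vec (0\<^sub>v n :: real vec)"
    then have c: "c < n" by simp
    have "(D *\<^sub>v ?x) $ c = (\<Sum>j<k * n. D $$ (c, j) * y (j div n) (j mod n))"
      using c by (auto simp: scalar_prod_def atLeast0LessThan intro!: sum.cong)
    also have "\<dots> = (\<Sum>j<k * n. col D j $ c * y (j div n) (j mod n))"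
      using c by (intro sum.cong) auto
    also have "\<dots> = (\<Sum>i<k. \<Sum>l<n. b i l $ c * y i l)"
      unfolding sum_blocks by (intro sum.cong refl) (auto simp: col_D block_div_mod)
    finally show "(D *\<^sub>v ?x) $ c = 0\<^sub>v n $ c" using assms c by simp
  qed simp
  then show ?thesis by (intro mat_kernelI[OF D_carrier]) auto
qed

lemma spark_eqI:
  assumes "\<And>x. x \<in> mat_kernel D \<Longrightarrow> x \<noteq> 0\<^sub>v (k * n) \<Longrightarrow> N \<le> l0_norm x"
    and "x \<in> mat_kernel D" "x \<noteq> 0\<^sub>v (k * n)" "l0_norm x \<le> N"
  shows "spark D = N"
  unfolding spark_def
proof (rule Min_eqI)
  have "l0_norm x \<le> k * n" if "x \<in> mat_kernel D" for x
  proof -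
    have "dim_vec x = k * n" using that mat_kernel[OF D_carrier] by auto
    then have "l0_norm x \<le> card {..<k * n}" unfolding l0_norm_def by (intro card_mono) auto
    then show ?thesis by simp
  qed
  then have "{l0_norm x |x. x \<in> mat_kernel D \<and> x \<noteq> 0\<^sub>v (dim_col D)} \<subseteq> {..k * n}" by auto
  then show "finite {l0_norm x |x. x \<in> mat_kernel D \<and> x \<noteq> 0\<^sub>v (dim_col D)}"
    by (rule finite_subset) simp
  show "N \<in> {l0_norm x |x. x \<in> mat_kernel D \<and> x \<noteq> 0\<^sub>v (dim_col D)}"
    using assms(1)[OF assms(2,3)] assms(2-4) by (auto intro!: exI[of _ x])
qed (use assms(1) in auto)

end

subsection \<open>The construction\<close>

theorem theorem1:
  fixes t r q :: nat
  assumes "t > 0" and "r > 0" and "q = 2 ^ r"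
  shows "\<exists>D. dictionary (q ^ (2 * t)) D \<and>
             union_of_orthonormal_bases (q ^ (2 * t)) (q + 1) D \<and>
             spark D = q ^ t + q ^ (t - 1) \<and>
             mutual_coherence D = 1 / real q ^ t"
proof -
  let ?k = "r * t"
  define E where "E = GF (?k * 2)"
  define U where "U = trace_kernel r t"
  define n where "n = q ^ (2 * t)"
  define m :: real where "m = 2 ^ ?k"
  have k: "?k > 0" using assms by simp
  have m: "m > 0" "m = real q ^ t" by (simp_all add: m_def assms(3) power_mult)
  have q: "q > 0" using assms by simp
  have n: "n > 0" "n = 2 ^ (?k * 2)"
    using q by (simp_all add: n_def assms(3) mult.commute flip: power_mult power_add)
  have finE: "finite E" "card E = n" using card_GF[of "?k * 2"] k by (simp_all add: E_def n(2))
  have finK: "finite (GF r)" "card (GF r) = q" using card_GF[OF assms(2)] assms(3) by simp_all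
  obtain f where f: "bij_betw f {..<q} (GF r)"
    using ex_bij_betw_nat_finite[OF finK(1)] finK(2) by (auto simp: atLeast0LessThan)
  obtain e where e: "bij_betw e {..<n} E"
    using ex_bij_betw_nat_finite[OF finE(1)] finE(2) by (auto simp: atLeast0LessThan)
  have fK: "f i \<in> GF r" "f i \<in> GF ?k" if "i < q" for i
    using that f bij_betwE[OF f] by (auto intro: GF_mono)
  have eE: "e l \<in> GF (?k * 2)" if "l < n" for l
    using that bij_betwE[OF e] by (auto simp: E_def)
  have f_eq: "f i = f i' \<longleftrightarrow> i = i'" if "i < q" "i' < q" for i i'
    using that f by (auto simp: bij_betw_def inj_on_eq_iff)
  have e_eq: "e l = e l' \<longleftrightarrow> l = l'" if "l < n" "l' < n" for l l'
    using that e by (auto simp: bij_betw_def inj_on_eq_iff)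
  have sum_e: "(\<Sum>l<n. g (e l)) = (\<Sum>x\<in>E. g x)" for g :: "gf \<Rightarrow> real"
    using sum.reindex_bij_betw[OF e] .
  have sum_f: "(\<Sum>i<q. g (f i)) = (\<Sum>a\<in>GF r. g a)" for g :: "gf \<Rightarrow> real"
    using sum.reindex_bij_betw[OF f] .

  \<comment> \<open>Blocks below \<open>q\<close> are the phase bases, normalised by
    \<open>m\<close> since \<open>n = m * m\<close>; block \<open>q\<close> is the standard basis.
    The enumeration \<open>e\<close> indexes both coordinates and frequencies.\<close>
  define b where "b = (\<lambda>i l. if i < q then vec n (\<lambda>c. phase ?k (f i) (e l) (e c) / m)
    else unit_vec n l)"
  \<comment> \<open>Phases multiply by adding parameters. For \<open>i = i'\<close> the quadratic
    parameter becomes 0 and the sum is linear; otherwise it is a Gauss sum.\<close>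
  have gram: "b i l \<bullet> b i' l' =
      (\<Sum>x\<in>E. phase ?k (f i + f i') (e l + e l') x) / (m * m)"
    if "i < q" "i' < q" "l < n" "l' < n" for i i' l l'
  proof -
    have "b i l \<bullet> b i' l' =
        (\<Sum>c<n. phase ?k (f i) (e l) (e c) * phase ?k (f i') (e l') (e c) / (m * m))"
      using that by (simp add: b_def scalar_prod_def atLeast0LessThan)
    also have "\<dots> = (\<Sum>c<n. phase ?k (f i + f i') (e l + e l') (e c) / (m * m))"
      using that by (intro sum.cong refl) (simp add: phase_mult fK eE)
    also have "\<dots> = (\<Sum>x\<in>E. phase ?k (f i + f i') (e l + e l') x / (m * m))"
      by (rule sum_e)
    finally show ?thesis by (simp only: sum_divide_distrib)
  qed
  interpret coherent_bases n "q + 1" "1 / m" b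
  proof
    show "n > 0" by (rule n(1))
    show "b i l \<in> carrier_vec n" if "i < q + 1" "l < n" for i l
      using that by (simp add: b_def)
    show "b i l \<bullet> b i l' = (if l = l' then 1 else 0)" if "i < q + 1" "l < n" "l' < n" for i l l'
    proof (cases "i < q")
      case True
      have "(2::real) ^ (?k * 2) = m * m" by (simp add: m_def power_mult power2_eq_square)
      then show ?thesis
        using that True m(1) sum_phase_linear[OF k GF_add[OF eE eE], of l l']
        by (auto simp: gram E_def gf_add_eq_0_iff e_eq)
    next
      case False
      then show ?thesis using that by (simp add: b_def)
    qed
    show "\<bar>b i l \<bullet> b i' l'\<bar> = 1 / m"
      if "i < q + 1" "i' < q + 1" "i \<noteq> i'" "l < n" "l' < n" for i i' l l'
    proof (cases "i < q \<and> i' < q")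
      case True
      then have "\<bar>\<Sum>x\<in>E. phase ?k (f i + f i') (e l + e l') x\<bar> = m"
        using that unfolding E_def m_def
        by (intro abs_gauss_sum k GF_add fK eE) (auto simp: gf_add_eq_0_iff f_eq)
      then show ?thesis using True that m(1) by (simp add: gram abs_mult)
    next
      case False
      \<comment> \<open>One basis is the standard one, so the inner product is a single coordinate
        of a phase vector.\<close>
      then have "i < q \<and> i' = q \<or> i = q \<and> i' < q" using that by linarith
      then show ?thesis
        using that m(1) by (auto simp: b_def)
    qed
  qed

  have U: "U \<subseteq> E" "0 \<in> U" "finite U" "card U \<le> q ^ (t - 1)"
    using card_trace_kernel[OF assms(2,1)] trace_kernel_subset[of r t]
    by (simp_all add: U_def E_def assms(3) flip: power_mult)
  define S where "S = {l. l < n \<and> e l \<in> U}"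
  have "e ` S = U" "inj_on e S"
    using e U(1) by (auto simp: S_def bij_betw_def inj_on_def image_iff)
  then have cardS: "card S = card U" by (metis card_image)
  \<comment> \<open>The phase vectors with frequency in \<open>U\<close> add up to
    \<open>real q * card U / m\<close> times the indicator of \<open>U\<close>; the coefficients in
    the standard basis cancel this.\<close>
  define y where "y = (\<lambda>i l. if e l \<in> U then if i < q then 1 else - (real q * card U / m) else 0)"
  define x where "x = vec ((q + 1) * n) (\<lambda>j. y (j div n) (j mod n))"
  have kernel: "x \<in> mat_kernel D"
    unfolding x_def
  proof (rule kernelI)
    fix c assume c: "c < n"
    have "(\<Sum>i<q. \<Sum>l<n. b i l $ c * y i l) =
        (\<Sum>i<q. \<Sum>l<n. if e l \<in> U then phase ?k (f i) (e l) (e c) / m else 0)"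
      using c by (intro sum.cong refl) (auto simp: b_def y_def)
    also have "\<dots> = (\<Sum>a\<in>GF r. \<Sum>w\<in>E. if w \<in> U then phase ?k a w (e c) / m else 0)"
      unfolding sum_f[symmetric] sum_e[symmetric] ..
    also have "\<dots> = (\<Sum>a\<in>GF r. \<Sum>w\<in>U. phase ?k a w (e c)) / m"
      using U(1) finE(1)
      by (simp add: Int_absorb1 sum_divide_distrib flip: sum.inter_restrict)
    also have "\<dots> = (if e c \<in> U then real q * card U / m else 0)"
      using sum_phase_trace_kernel[OF assms(2,1) eE[OF c]] by (simp add: U_def assms(3))
    finally have "(\<Sum>i<q. \<Sum>l<n. b i l $ c * y i l) = - y q c"
      by (simp add: y_def)
    moreover have "(\<Sum>l<n. b q l $ c * y q l) = (\<Sum>l<n. if l = c then y q c else 0)"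
      using c by (intro sum.cong) (auto simp: b_def)
    ultimately show "(\<Sum>i<q + 1. \<Sum>l<n. b i l $ c * y i l) = 0"
      using c by simp
  qed
  have x_index: "x $ (i * n + l) = y i l" if "i < q + 1" "l < n" for i l
    using block_div_mod[OF that] by (simp add: x_def)
  \<comment> \<open>The zero of the field lies in \<open>U\<close>, so position \<open>l0\<close> of
    block 0 has coefficient 1.\<close>
  obtain l0 where l0: "l0 < n" "e l0 = 0"
    using e U(1,2) by (auto simp: bij_betw_def image_iff subset_iff)
  have "x $ l0 = 1" using x_index[of 0 l0] l0 U(2) q by (simp add: y_def)
  then have nonzero: "x \<noteq> 0\<^sub>v ((q + 1) * n)" using l0 by auto
  have pt: "(q + 1) * q ^ (t - 1) = q ^ t + q ^ (t - 1)"
    using assms(1) by (cases t) auto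
  have "l0_norm x = (\<Sum>i<q + 1. card {l. l < n \<and> x $ (i * n + l) \<noteq> 0})"
    by (rule l0_norm_blocks) (simp add: x_def)
  also have "\<dots> \<le> (\<Sum>i<q + 1. card S)"
    by (intro sum_mono card_mono) (auto simp: S_def x_index y_def split: if_splits)
  also have "\<dots> \<le> (q + 1) * q ^ (t - 1)"
    using mult_le_mono2[OF U(4), of "q + 1"] by (simp add: cardS)
  finally have upper: "l0_norm x \<le> q ^ t + q ^ (t - 1)" unfolding pt .
  have lower: "q ^ t + q ^ (t - 1) \<le> l0_norm z"
    if "z \<in> mat_kernel D" "z \<noteq> 0\<^sub>v ((q + 1) * n)" for z
  proof -
    have "real q + 1 \<le> real q * (1 / m) * real (l0_norm z)"
      using m(1) q that by (intro kernel_l0_lower_bound) auto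
    then have "(real q + 1) * m \<le> real q * real (l0_norm z)"
      using m(1) by (simp add: field_simps)
    \<comment> \<open>One factor \<open>q\<close> is split off \<open>m\<close> to cancel the
      \<open>q\<close> on the right, leaving exactly \<open>(q + 1) * q ^ (t - 1)\<close>.\<close>
    moreover have "m = real q * real q ^ (t - 1)" using assms(1) m(2) by (cases t) auto
    ultimately have "real q * ((real q + 1) * real q ^ (t - 1)) \<le> real q * real (l0_norm z)"
      by (simp add: mult_ac)
    then have "(real q + 1) * real q ^ (t - 1) \<le> real (l0_norm z)" using q by simp
    then have "real ((q + 1) * q ^ (t - 1)) \<le> real (l0_norm z)" by (simp add: algebra_simps)
    then show ?thesis unfolding pt by (simp only: of_nat_le_iff)
  qed
  have "spark D = q ^ t + q ^ (t - 1)"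
    using lower kernel nonzero upper by (rule spark_eqI)
  moreover have "mutual_coherence D = 1 / real q ^ t"
    using coherence_D q m(2) by simp
  ultimately show ?thesis
    using dictionary_D union_D unfolding n_def by auto
qed

end
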